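(* Let $k\in\mathbb{N}$, $0<\tau\le 1$, $0<\mu\le 1$, $0\le\tau-\mu<1$, $0\le\delta<1$, $0\le\gamma<1$ and $\tau-\mu+\gamma<1$. Let $f_1(z)=z-\sum_{\nu=k+1}^{\infty}a_{\nu,1}z^\nu$ and $f_2(z)=z-\sum_{\nu=k+1}^{\infty}a_{\nu,2}z^\nu$, with $a_{\nu,1}\ge 0$ and $a_{\nu,2}\ge 0$, both be in the class $\mathcal{P}_{\tau,\mu}(k,\delta,\gamma)$. Then the function $$\Phi(z)=z-\frac12\sum_{\nu=k+1}^{\infty}(a_{\nu,1}+a_{\nu,2})z^\nu$$ is also in the class $\mathcal{P}_{\tau,\mu}(k,\delta,\gamma)$.
   Context: $\mathbb{U}=\{z\in\mathbb{C}:|z|<1\}$, $\mathbb{N}=\{1,2,3,\dots\}$. For $k\in\mathbb{N}$, $\mathcal{P}(k)$ is the class of functions that are analytic and univalent in $\mathbb{U}$ and of the form $f(z)=z-\sum_{\nu=k+1}^{\infty}a_\nu z^\nu$ with all $a_\nu\ge 0$. Srivastava-Owa fractional derivative: for $0\le\varsigma<1$, $\mathfrak{D}_z^{\varsigma}g(z)=\frac{1}{\Gamma(1-\varsigma)}\frac{d}{dz}\int_0^z g(\zeta)(z-\zeta)^{-\varsigma}\,d\zeta$, where the multiplicity of $(z-\zeta)^{-\varsigma}$ is removed by requiring $\log(z-\zeta)$ to be real when $z-\zeta>0$. Tremblay operator: for $0<\tau\le 1$, $0<\mu\le 1$, $0\le\tau-\mu<1$, $\mathfrak{T}^{\tau,\mu}f(z)=\frac{\Gamma(\mu)}{\Gamma(\tau)}z^{1-\mu}\,\mathfrak{D}_z^{\tau-\mu}\big[z^{\tau-1}f(z)\big]$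 for $z\in\mathbb{U}$. (Powers of $z$ and $\zeta$ are taken with the principal branch and the integral along the segment from $0$ to $z$; the resulting function is understood as extended analytically to all of $\mathbb{U}$, including $z=0$ and the negative real axis.) Class $\mathcal{P}_{\tau,\mu}(k,\delta,\gamma)$ (with $0<\tau\le1$, $0<\mu\le1$, $0\le\tau-\mu<1$, $0\le\delta<1$, $0\le\gamma<1$, $\tau-\mu+\gamma<1$): the set of $f\in\mathcal{P}(k)$ such that for all $z\in\mathbb{U}$ $$\Re\left(\frac{\Gamma(\mu+1)\Gamma(\tau)}{\Gamma(\tau+1)\Gamma(\mu)}z^{-1}\left[(1-\delta)\mathfrak{T}^{\tau,\mu}f(z)+\delta z\big(\mathfrak{T}^{\tau,\mu}f\big)'(z)\right]\right)>\gamma,$$ the value at $z=0$ being understood by removing the singularity. *)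

theory Defs
  imports "HOL-Complex_Analysis.Complex_Analysis"
begin

abbreviation unit_disc :: "complex set" where
  "unit_disc \<equiv> ball 0 1"

definition has_neg_expansion :: "nat \<Rightarrow> (nat \<Rightarrow> real) \<Rightarrow> (complex \<Rightarrow> complex) \<Rightarrow> bool" where
  "has_neg_expansion k a f \<longleftrightarrow>
     (\<forall>\<nu>\<ge>k+1. a \<nu> \<ge> 0) \<and>
     (\<forall>z\<in>unit_disc.
        (\<lambda>\<nu>. of_real (a \<nu>) * z ^ \<nu>) summable_on {k+1..} \<and>
        f z = z - (\<Sum>\<^sub>\<infinity>\<nu>\<in>{k+1..}. of_real (a \<nu>) * z ^ \<nu>))"

definition class_P :: "nat \<Rightarrow> (complex \<Rightarrow> complex) set" where
  "class_P k = {f. f holomorphic_on unit_disc \<and> inj_on f unit_disc \<and>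
                   (\<exists>a. has_neg_expansion k a f)}"

text \<open>
  The Srivastava-Owa fractional derivative. The principal branch of \<^const>\<open>powr\<close> is
  continuous along the segment as long as \<open>z\<close> is not a nonpositive real; the formula is
  only used for such \<open>z\<close>.
\<close>
definition frac_deriv :: "real \<Rightarrow> (complex \<Rightarrow> complex) \<Rightarrow> complex \<Rightarrow> complex" where
  "frac_deriv \<sigma> g z =
     1 / of_real (Gamma (1 - \<sigma>)) *
     deriv (\<lambda>w. contour_integral (linepath 0 w)
                  (\<lambda>\<zeta>. g \<zeta> * (w - \<zeta>) powr of_real (- \<sigma>))) z"

definition tremblay_slit :: "real \<Rightarrow> real \<Rightarrow> (complex \<Rightarrow> complex) \<Rightarrow> complex \<Rightarrow> complex" where
  "tremblay_slit \<tau> \<mu> f z =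
     of_real (Gamma \<mu> / Gamma \<tau>) * z powr of_real (1 - \<mu>) *
     frac_deriv (\<tau> - \<mu>) (\<lambda>\<zeta>. \<zeta> powr of_real (\<tau> - 1) * f \<zeta>) z"

text \<open>
  The Tremblay operator: the analytic extension to the whole disc of the formula above, which
  is meaningful on the disc slit along the nonpositive reals. By the identity theorem the
  extension is unique on the disc; values outside the disc are irrelevant.
\<close>
definition tremblay :: "real \<Rightarrow> real \<Rightarrow> (complex \<Rightarrow> complex) \<Rightarrow> complex \<Rightarrow> complex" where
  "tremblay \<tau> \<mu> f =
     (SOME F. F holomorphic_on unit_disc \<and>
              (\<forall>z\<in>unit_disc - \<real>\<^sub>\<le>\<^sub>0. F z = tremblay_slit \<tau> \<mu> f z))"

text \<open>\<^const>\<open>remove_sings\<close> supplies the value at \<open>0\<close>, where the quotient has a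
  removable singularity.\<close>
definition class_P_tremblay ::
  "real \<Rightarrow> real \<Rightarrow> nat \<Rightarrow> real \<Rightarrow> real \<Rightarrow> (complex \<Rightarrow> complex) set" where
  "class_P_tremblay \<tau> \<mu> k \<delta> \<gamma> =
     {f \<in> class_P k. \<forall>z\<in>unit_disc.
        Re (remove_sings
              (\<lambda>w. of_real (Gamma (\<mu> + 1) * Gamma \<tau> / (Gamma (\<tau> + 1) * Gamma \<mu>)) * inverse w *
                   (of_real (1 - \<delta>) * tremblay \<tau> \<mu> f w
                    + of_real \<delta> * w * deriv (tremblay \<tau> \<mu> f) w)) z) > \<gamma>}"

end

theory Submission
  imports Defs
begin

text \<open>
  Substituting \<open>\<zeta> = w t\<close> in the integral of \<open>\<zeta> powr (\<tau>-1) * f \<zeta> * (w-\<zeta>) powr (-\<sigma>)\<close>, where \<open>\<sigma> = \<tau> - \<mu>\<close>, gives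
  \<open>w powr \<mu> * G w\<close> with \<open>G w = \<integral> t powr (\<tau>-1) * (1-t) powr (-\<sigma>) * f (t w) dt\<close> over \<open>[0,1]\<close>.
  The function \<open>G\<close> is holomorphic on the disc, so the Tremblay operator is a constant multiple
  of \<open>\<mu> G z + z G' z\<close>. It is therefore linear, and the real part condition is preserved by averaging.
  Univalence is the only nonlinear condition. For \<open>f = z - \<Sum> a\<^sub>\<nu> z\<^sup>\<nu>\<close> with \<open>a\<^sub>\<nu> \<ge> 0\<close> it is equivalent to
  positivity of \<open>Re f'\<close>: injectivity keeps the real function \<open>f'\<close> on \<open>[0,1)\<close> away from \<open>0\<close>, hence positive,
  and \<open>|1 - f' z| \<le> 1 - f' |z|\<close>. Conversely \<open>Re f' > 0\<close> on a convex set implies injectivity.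
\<close>

subsection \<open>Univalence\<close>

lemma deriv_average:
  assumes "f holomorphic_on S" "g holomorphic_on S" "open S"
    and eq: "\<And>z. z \<in> S \<Longrightarrow> h z = (f z + g z) / 2" and z: "z \<in> S"
  shows "deriv h z = (deriv f z + deriv g z) / 2"
proof -
  have "\<forall>\<^sub>F w in nhds z. h w = (f w + g w) / 2"
    using eventually_nhds_in_open[OF assms(3) z] by eventually_elim (rule eq)
  then have "deriv h z = deriv (\<lambda>w. (f w + g w) / 2) z"
    by (rule deriv_cong_ev) simp
  also have "\<dots> = (deriv f z + deriv g z) / 2"
    by (intro DERIV_imp_deriv DERIV_cdivide DERIV_add
        holomorphic_derivI[OF assms(1,3) z] holomorphic_derivI[OF assms(2,3) z])
  finally show ?thesis .
qed

text \<open>The Noshiro-Warschawski criterion, by the mean value theorem for real parts along the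
  segment, which convexity keeps inside \<open>S\<close>.\<close>

lemma inj_on_if_Re_deriv_pos:
  assumes "f holomorphic_on S" "open S" "convex S" "\<And>z. z \<in> S \<Longrightarrow> Re (deriv f z) > 0"
  shows "inj_on f S"
proof (rule inj_onI, rule ccontr)
  fix w z assume wz: "w \<in> S" "z \<in> S" "f w = f z" "w \<noteq> z"
  have seg: "closed_segment w z \<subseteq> S"
    using assms(3) wz by (simp add: closed_segment_subset)
  \<comment> \<open>Division by \<open>z - w\<close> cancels the increment that the mean value
    theorem multiplies onto the derivative, leaving \<open>Re (deriv f u)\<close>.\<close>
  have "((\<lambda>u. f u / (z - w)) has_field_derivative deriv f u / (z - w)) (at u)"
    if "u \<in> closed_segment w z" for u
    using seg that by (intro DERIV_cdivide holomorphic_derivI[OF assms(1,2)]) auto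
  from complex_mvt_line[OF this] obtain u where
    u: "u \<in> closed_segment w z"
       "Re (f z / (z - w)) - Re (f w / (z - w)) = Re (deriv f u / (z - w) * (z - w))"
    by blast
  have "Re (deriv f u) = 0"
    using u(2) wz by simp
  with assms(4)[of u] u(1) seg show False by auto
qed

text \<open>Nonnegative coefficients make \<open>1 - deriv f\<close> largest in modulus on each
  circle at its positive real point, so the sign on \<open>[0,1)\<close> decides the whole disc;
  there a real derivative that starts at 1 and never vanishes stays positive.\<close>

lemma Re_deriv_pos_if_neg_expansion:
  assumes k: "k \<ge> 1" and exp: "has_neg_expansion k a f"
    and hol: "f holomorphic_on unit_disc" and inj: "inj_on f unit_disc"
    and z: "z \<in> unit_disc"
  shows "Re (deriv f z) > 0"
proof -
  \<comment> \<open>Padding with zeros below \<open>k+1\<close> gives a power series over all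
    indices, as termwise differentiation requires.\<close>
  define b where "b \<nu> = (if \<nu> \<ge> k+1 then a \<nu> else 0)" for \<nu>
  define d where "d = diffs b"
  have b0: "b \<nu> \<ge> 0" for \<nu>
    using exp by (auto simp: b_def has_neg_expansion_def)
  then have d0: "d \<nu> \<ge> 0" for \<nu>
    by (simp add: d_def diffs_def)
  have b1: "b 0 = 0" "b 1 = 0" using k by (auto simp: b_def)
  have sums: "(\<lambda>\<nu>. of_real (b \<nu>) * w ^ \<nu>) sums (w - f w)" if "w \<in> unit_disc" for w
  proof -
    have "((\<lambda>\<nu>. of_real (a \<nu>) * w ^ \<nu>) has_sum (w - f w)) {k+1..}"
      using exp that by (auto simp: has_neg_expansion_def)
    then have "((\<lambda>\<nu>. of_real (b \<nu>) * w ^ \<nu>) has_sum (w - f w)) UNIV"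
      by (rule has_sum_cong_neutral[THEN iffD1, rotated -1]) (auto simp: b_def)
    then show ?thesis by (rule has_sum_imp_sums)
  qed
  define P where "P w = (\<Sum>\<nu>. complex_of_real (d \<nu>) * w ^ \<nu>)" for w
  have diffs_eq: "complex_of_real (d \<nu>) = diffs (\<lambda>\<nu>. of_real (b \<nu>)) \<nu>" for \<nu>
    by (simp add: d_def diffs_def)
  have deriv: "deriv f w = 1 - P w" if w: "w \<in> unit_disc" for w
  proof -
    have "((\<lambda>w. \<Sum>\<nu>. of_real (b \<nu>) * w ^ \<nu>) has_field_derivative P w) (at w)"
      unfolding P_def diffs_eq
      by (rule termdiffs_strong'[where K = 1]) (use sums w in \<open>auto simp: sums_iff\<close>)
    then have "((\<lambda>w. w - (\<Sum>\<nu>. of_real (b \<nu>) * w ^ \<nu>)) has_field_derivative 1 - P w) (at w)"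
      by (intro derivative_intros)
    then have "(f has_field_derivative 1 - P w) (at w)"
      by (rule DERIV_cong_ev[THEN iffD1, rotated -1])
         (use sums w in \<open>auto simp: sums_iff intro!: eventually_nhds_in_open[THEN eventually_mono, of unit_disc]\<close>)
    then show ?thesis by (rule DERIV_imp_deriv)
  qed
  have summ: "summable (\<lambda>\<nu>. complex_of_real (d \<nu>) * w ^ \<nu>)" if "w \<in> unit_disc" for w
    unfolding diffs_eq
    by (rule termdiff_converges[where K = 1]) (use sums that in \<open>auto simp: sums_iff\<close>)
  have P_real: "P (of_real r) = of_real (\<Sum>\<nu>. d \<nu> * r ^ \<nu>)" and summ_real: "summable (\<lambda>\<nu>. d \<nu> * r ^ \<nu>)"
    if "0 \<le> r" "r < 1" for r
  proof -
    have eq: "(\<lambda>\<nu>. complex_of_real (d \<nu>) * of_real r ^ \<nu>) = (\<lambda>\<nu>. of_real (d \<nu> * r ^ \<nu>))"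
      by simp
    have "summable (\<lambda>\<nu>. complex_of_real (d \<nu> * r ^ \<nu>))"
      using summ[of "of_real r"] that unfolding eq by auto
    then show "summable (\<lambda>\<nu>. d \<nu> * r ^ \<nu>)"
      by (simp only: summable_complex_of_real)
    then show "P (of_real r) = of_real (\<Sum>\<nu>. d \<nu> * r ^ \<nu>)"
      unfolding P_def eq by (rule suminf_of_real[symmetric])
  qed
  define h where "h r = Re (deriv f (of_real r))" for r :: real
  \<comment> \<open>Injectivity makes \<open>deriv f\<close> nonzero; at real points it is real, so
    its real part is already nonzero.\<close>
  have nz: "h r \<noteq> 0" if "0 \<le> r" "r < 1" for r
    using holomorphic_injective_imp_regular[OF hol open_ball inj, of "of_real r"] that
    by (auto simp: h_def deriv P_real complex_eq_iff)
  have pos: "h r > 0" if "0 \<le> r" "r < 1" for r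
  proof (rule ccontr)
    assume "\<not> h r > 0"
    \<comment> \<open>The constant term of \<open>P\<close> is \<open>d 0 = b 1\<close>, which
      vanishes because the expansion starts at index 2 or later.\<close>
    moreover have "h 0 = 1"
      using b1 by (simp add: h_def deriv P_def d_def diffs_def)
    moreover have "continuous_on {0..r} h"
      unfolding h_def
      by (intro continuous_intros continuous_on_compose2[OF holomorphic_on_imp_continuous_on
            [OF holomorphic_deriv[OF hol open_ball]]]) (use that in auto)
    ultimately have "\<exists>x\<ge>0. x \<le> r \<and> h x = 0"
      using IVT2'[of h r 0 0] that by auto
    then obtain x where "0 \<le> x" "x \<le> r" "h x = 0" by blast
    with nz[of x] that show False by auto
  qed
  have r: "0 \<le> norm z" "norm z < 1" using z by auto
  have "norm (P z) \<le> (\<Sum>\<nu>. norm (complex_of_real (d \<nu>) * z ^ \<nu>))"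
    unfolding P_def using summ_real[OF r] d0
    by (intro summable_norm) (simp add: norm_mult norm_power)
  also have "\<dots> = (\<Sum>\<nu>. d \<nu> * norm z ^ \<nu>)"
    using d0 by (simp add: norm_mult norm_power)
  also have "\<dots> = 1 - h (norm z)"
    using r by (simp add: h_def deriv P_real)
  finally show ?thesis
    using pos[OF r] complex_Re_le_cmod[of "P z"] by (simp add: deriv[OF z])
qed

subsection \<open>The Tremblay operator\<close>

text \<open>An unnormalised fractional integral of Erdelyi-Kober type: for \<tau> > 0 and \<sigma> <
  1 it multiplies the n-th Taylor coefficient by the Beta value B(\<tau> + n, 1 - \<sigma>).\<close>

definition beta_average :: "real \<Rightarrow> real \<Rightarrow> (complex \<Rightarrow> complex) \<Rightarrow> complex \<Rightarrow> complex" where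
  "beta_average \<tau> \<sigma> f w =
     integral {0..1} (\<lambda>t. of_real (t powr (\<tau> - 1) * (1 - t) powr (- \<sigma>)) * f (of_real t * w))"

text \<open>Termwise integration of the Taylor series against the beta weight gives a power series
  for the average, hence holomorphy. Dominated convergence yields both the interchange and the
  integrability of the limit.\<close>

lemma
  assumes "\<tau> > 0" "\<sigma> < 1" and hol: "f holomorphic_on unit_disc"
  shows integrable_beta_average: "w \<in> unit_disc \<Longrightarrow>
      (\<lambda>t. of_real (t powr (\<tau> - 1) * (1 - t) powr (- \<sigma>)) * f (of_real t * w)) integrable_on {0..1}"
    and holomorphic_beta_average: "beta_average \<tau> \<sigma> f holomorphic_on unit_disc"
proof -
  define c where "c n = (deriv ^^ n) f 0 / fact n" for n
  define \<beta> where "\<beta> t = t powr (\<tau> - 1) * (1 - t) powr (- \<sigma>)" for t :: real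
  define m where "m n = integral {0..1} (\<lambda>t. complex_of_real (\<beta> t * t ^ n))" for n
  have \<beta>0: "\<beta> t \<ge> 0" for t by (simp add: \<beta>_def)
  have \<beta>_int: "\<beta> integrable_on {0..1}"
    unfolding \<beta>_def using integrable_Beta'[of \<tau> "1 - \<sigma>"] assms by simp
  have m: "(\<lambda>t. complex_of_real (\<beta> t * t ^ n)) integrable_on {0..1}" for n
  proof -
    \<comment> \<open>The power \<open>t ^ n\<close> shifts the first Beta parameter by n. Merging
      it into \<open>powr\<close> is done for positive \<open>t\<close>, so the point 0 is
      discarded.\<close>
    have int: "(\<lambda>t. t powr (\<tau> + real n - 1) * (1 - t) powr (- \<sigma>)) integrable_on {0..1}"
      using integrable_Beta'[of "\<tau> + real n" "1 - \<sigma>"] assms by simp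
    have "(\<lambda>t. \<beta> t * t ^ n) integrable_on {0..1}"
    proof (rule integrable_spike_finite[OF _ _ int])
      show "\<beta> t * t ^ n = t powr (\<tau> + real n - 1) * (1 - t) powr (- \<sigma>)"
        if "t \<in> {0..1} - {0}" for t
        using that by (simp add: \<beta>_def powr_add powr_diff powr_realpow)
    qed simp
    from integrable_linear[OF this bounded_linear_of_real] show ?thesis
      by (simp add: o_def)
  qed
  have f_sums: "(\<lambda>n. c n * w ^ n) sums f w" if "w \<in> unit_disc" for w
    using holomorphic_power_series[OF hol that] by (simp add: c_def)
  have main: "(\<lambda>t. of_real (\<beta> t) * f (of_real t * w)) integrable_on {0..1}"
    "(\<lambda>n. m n * c n * w ^ n) sums beta_average \<tau> \<sigma> f w" if w: "w \<in> unit_disc" for w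
  proof -
    \<comment> \<open>Partial sums of the integrand, dominated by \<open>M\<close> times the weight
      since \<open>t ^ n\<close> is at most 1 on the unit interval.\<close>
    define S where "S N t = (\<Sum>n<N. (c n * w ^ n) * of_real (\<beta> t * t ^ n))" for N t
    define M where "M = (\<Sum>n. norm (c n * w ^ n))"
    have abs: "summable (\<lambda>n. norm (c n * w ^ n))"
    proof -
      obtain r where r: "norm w < r" "r < 1" using w dense[of "norm w" 1] by auto
      moreover have "norm r < 1" "norm w < norm (complex_of_real r)"
        using r norm_ge_zero[of w] by (auto simp del: norm_ge_zero)
      ultimately show ?thesis
        using f_sums[of "of_real r"] by (intro powser_insidea[of c "of_real r"]) (auto simp: sums_iff)
    qed
    have S_int: "S N integrable_on {0..1}" for N
      unfolding S_def by (intro integrable_sum integrable_on_mult_right m) auto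
    have M_int: "(\<lambda>t. M * \<beta> t) integrable_on {0..1}"
      by (intro integrable_on_mult_right \<beta>_int)
    have bound: "norm (S N t) \<le> M * \<beta> t" if t: "t \<in> {0..1}" for N t
    proof -
      have "norm (S N t) \<le> (\<Sum>n<N. norm (c n * w ^ n) * \<beta> t)"
        unfolding S_def
      proof (rule sum_norm_le)
        fix n
        have "norm (complex_of_real (\<beta> t * t ^ n)) \<le> \<beta> t"
          using t \<beta>0[of t] by (simp add: norm_mult norm_power mult_left_le power_le_one)
        then show "norm (c n * w ^ n * complex_of_real (\<beta> t * t ^ n)) \<le> norm (c n * w ^ n) * \<beta> t"
          by (subst norm_mult) (intro mult_left_mono, auto)
      qed
      also have "\<dots> = (\<Sum>n<N. norm (c n * w ^ n)) * \<beta> t"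
        by (simp add: sum_distrib_right)
      also have "\<dots> \<le> M * \<beta> t"
        unfolding M_def using abs \<beta>0 by (intro mult_right_mono sum_le_suminf) auto
      finally show ?thesis .
    qed
    have lim: "(\<lambda>N. S N t) \<longlonglongrightarrow> of_real (\<beta> t) * f (of_real t * w)" if t: "t \<in> {0..1}" for t
    proof -
      have "norm (of_real t * w) < 1"
        using t w mult_left_le_one_le[of "norm w" t] by (auto simp: norm_mult)
      then have "(\<lambda>n. of_real (\<beta> t) * (c n * (of_real t * w) ^ n)) sums
                   (of_real (\<beta> t) * f (of_real t * w))"
        by (intro sums_mult f_sums) auto
      then show ?thesis
        by (simp add: sums_def S_def mult_ac power_mult_distrib)
    qed
    note dc = dominated_convergence[OF S_int M_int bound lim]
    show "(\<lambda>t. of_real (\<beta> t) * f (of_real t * w)) integrable_on {0..1}"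
      by (rule dc)
    have "integral {0..1} (S N) = (\<Sum>n<N. m n * c n * w ^ n)" for N
      unfolding S_def m_def
      by (subst integral_sum)
         (auto intro!: integrable_on_mult_right m simp: mult_ac simp del: of_real_mult)
    with dc(2) show "(\<lambda>n. m n * c n * w ^ n) sums beta_average \<tau> \<sigma> f w"
      by (simp add: sums_def beta_average_def \<beta>_def)
  qed
  show "w \<in> unit_disc \<Longrightarrow>
      (\<lambda>t. of_real (t powr (\<tau> - 1) * (1 - t) powr (- \<sigma>)) * f (of_real t * w)) integrable_on {0..1}"
    using main(1) unfolding \<beta>_def .
  show "beta_average \<tau> \<sigma> f holomorphic_on unit_disc"
    using main(2) by (intro power_series_holomorphic[where a = "\<lambda>n. m n * c n"]) simp
qed

text \<open>The substitution \<zeta> = t w, done pointwise on the integrands: \<open>t\<close> and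
  \<open>1 - t\<close> are nonnegative reals, so they split off from the principal powers whatever
  the argument of \<open>w\<close>.\<close>

lemma contour_integral_eq_beta_average:
  assumes "w \<noteq> 0"
  shows "contour_integral (linepath 0 w)
           (\<lambda>\<zeta>. \<zeta> powr of_real (\<tau> - 1) * f \<zeta> * (w - \<zeta>) powr of_real (- \<sigma>))
         = w powr of_real (\<tau> - \<sigma>) * beta_average \<tau> \<sigma> f w"
proof -
  \<comment> \<open>Two factors come from the powers in the integrand, the third from d\<zeta> = w
    dt.\<close>
  have w: "w powr of_real (\<tau> - 1) * w powr of_real (- \<sigma>) * w = w powr of_real (\<tau> - \<sigma>)"
  proof -
    have "w powr of_real (\<tau> - 1) * w powr of_real (- \<sigma>) * w =
            w powr of_real (\<tau> - 1) * w powr of_real (- \<sigma>) * w powr 1"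
      using assms by simp
    also have "\<dots> = w powr of_real (\<tau> - \<sigma>)"
      by (simp only: powr_add[symmetric]) simp
    finally show ?thesis .
  qed
  have "contour_integral (linepath 0 w)
           (\<lambda>\<zeta>. \<zeta> powr of_real (\<tau> - 1) * f \<zeta> * (w - \<zeta>) powr of_real (- \<sigma>))
        = integral {0..1} (\<lambda>t. (of_real t * w) powr of_real (\<tau> - 1) * f (of_real t * w) *
                               (w - of_real t * w) powr of_real (- \<sigma>) * w)"
    by (simp add: contour_integral_integral linepath_def scaleR_conv_of_real)
  also have "\<dots> = integral {0..1} (\<lambda>t. w powr of_real (\<tau> - \<sigma>) *
      (of_real (t powr (\<tau> - 1) * (1 - t) powr (- \<sigma>)) * f (of_real t * w)))"
  proof (rule integral_cong)
    fix t :: real assume t: "t \<in> {0..1}"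
    have 1: "(of_real t * w) powr of_real (\<tau> - 1) = of_real (t powr (\<tau> - 1)) * w powr of_real (\<tau> - 1)"
      using t by (subst powr_times_real_left) (auto simp: powr_of_real[symmetric])
    have "w - of_real t * w = of_real (1 - t) * w"
      by (simp add: algebra_simps)
    then have 2: "(w - of_real t * w) powr of_real (- \<sigma>) =
                    of_real ((1 - t) powr (- \<sigma>)) * w powr of_real (- \<sigma>)"
      using t by (simp only: powr_of_real[symmetric], subst powr_times_real_left)
                 (auto simp: powr_of_real[symmetric])
    show "(of_real t * w) powr of_real (\<tau> - 1) * f (of_real t * w) *
            (w - of_real t * w) powr of_real (- \<sigma>) * w =
          w powr of_real (\<tau> - \<sigma>) *
            (of_real (t powr (\<tau> - 1) * (1 - t) powr (- \<sigma>)) * f (of_real t * w))"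
      unfolding 1 2 w[symmetric] by (simp add: mult_ac)
  qed
  also have "\<dots> = w powr of_real (\<tau> - \<sigma>) * beta_average \<tau> \<sigma> f w"
    by (simp add: beta_average_def)
  finally show ?thesis .
qed

text \<open>What the product rule on w^\<mu> G(w) leaves of the Tremblay formula: the prefactor
  z^(1-\<mu>) cancels all fractional powers, so the expression makes sense at 0 and on the negative
  axis.\<close>

definition tremblay_ext :: "real \<Rightarrow> real \<Rightarrow> (complex \<Rightarrow> complex) \<Rightarrow> complex \<Rightarrow> complex" where
  "tremblay_ext \<tau> \<mu> f z =
     of_real (Gamma \<mu> / (Gamma \<tau> * Gamma (1 - (\<tau> - \<mu>)))) *
     (of_real \<mu> * beta_average \<tau> (\<tau> - \<mu>) f z + z * deriv (beta_average \<tau> (\<tau> - \<mu>) f) z)"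

lemma tremblay_slit_eq:
  assumes "\<tau> > 0" "\<tau> - \<mu> < 1" "f holomorphic_on unit_disc" and z: "z \<in> unit_disc - \<real>\<^sub>\<le>\<^sub>0"
  shows "tremblay_slit \<tau> \<mu> f z = tremblay_ext \<tau> \<mu> f z"
proof -
  define G where "G = beta_average \<tau> (\<tau> - \<mu>) f"
  have hol: "G holomorphic_on unit_disc"
    unfolding G_def using assms by (intro holomorphic_beta_average) auto
  have z0: "z \<noteq> 0" using z by auto
  have "((\<lambda>w. w powr of_real \<mu> * G w) has_field_derivative
           of_real \<mu> * z powr (of_real \<mu> - 1) * G z + deriv G z * z powr of_real \<mu>) (at z)"
    using z by (intro DERIV_mult has_field_derivative_powr holomorphic_derivI[OF hol]) auto
  \<comment> \<open>The derivative depends only on values near \<open>z\<close>, and points near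
    \<open>z \<noteq> 0\<close> are nonzero, as the integral formula requires.\<close>
  moreover have "\<forall>\<^sub>F w in nhds z.
      contour_integral (linepath 0 w)
        (\<lambda>\<zeta>. \<zeta> powr of_real (\<tau> - 1) * f \<zeta> * (w - \<zeta>) powr of_real (- (\<tau> - \<mu>)))
      = w powr of_real \<mu> * G w"
    using t1_space_nhds[OF z0]
  proof eventually_elim
    case (elim w)
    then show ?case
      using contour_integral_eq_beta_average[of w \<tau> f "\<tau> - \<mu>"] by (simp add: G_def)
  qed
  ultimately have "deriv (\<lambda>w. contour_integral (linepath 0 w)
        (\<lambda>\<zeta>. \<zeta> powr of_real (\<tau> - 1) * f \<zeta> * (w - \<zeta>) powr of_real (- (\<tau> - \<mu>)))) z
      = of_real \<mu> * z powr (of_real \<mu> - 1) * G z + deriv G z * z powr of_real \<mu>"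
    by (subst deriv_cong_ev) (auto intro: DERIV_imp_deriv)
  then have "tremblay_slit \<tau> \<mu> f z = of_real (Gamma \<mu> / (Gamma \<tau> * Gamma (1 - (\<tau> - \<mu>)))) *
      (of_real \<mu> * (z powr of_real (1 - \<mu>) * z powr (of_real \<mu> - 1)) * G z
       + deriv G z * (z powr of_real (1 - \<mu>) * z powr of_real \<mu>))"
    unfolding tremblay_slit_def frac_deriv_def by (simp add: divide_simps) (simp add: algebra_simps)
  moreover have "z powr of_real (1 - \<mu>) * z powr (of_real \<mu> - 1) = 1"
    using z0 by (simp add: powr_add[symmetric])
  moreover have "z powr of_real (1 - \<mu>) * z powr of_real \<mu> = z"
    using z0 by (simp add: powr_add[symmetric])
  ultimately show ?thesis
    unfolding tremblay_ext_def G_def[symmetric] by (simp only: mult_1_right mult.commute[of "deriv G z"])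
qed

lemma holomorphic_tremblay_ext:
  assumes "\<tau> > 0" "\<tau> - \<mu> < 1" "f holomorphic_on unit_disc"
  shows "tremblay_ext \<tau> \<mu> f holomorphic_on unit_disc"
  unfolding tremblay_ext_def
  by (intro holomorphic_intros holomorphic_deriv holomorphic_beta_average) (use assms in auto)

text \<open>\<open>tremblay_ext\<close> witnesses that the choice in \<open>tremblay\<close> can be
  met, and the identity theorem on the nonempty open slit disc forces any choice to agree with it on
  the disc.\<close>

lemma tremblay_eq_tremblay_ext:
  assumes "\<tau> > 0" "\<tau> - \<mu> < 1" "f holomorphic_on unit_disc" and z: "z \<in> unit_disc"
  shows "tremblay \<tau> \<mu> f z = tremblay_ext \<tau> \<mu> f z"
proof -
  define Q where "Q F \<longleftrightarrow> F holomorphic_on unit_disc \<and>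
    (\<forall>z\<in>unit_disc - \<real>\<^sub>\<le>\<^sub>0. F z = tremblay_slit \<tau> \<mu> f z)" for F
  have "Q (tremblay_ext \<tau> \<mu> f)"
    using assms by (simp add: Q_def holomorphic_tremblay_ext tremblay_slit_eq)
  then have Q: "Q (tremblay \<tau> \<mu> f)"
    unfolding tremblay_def Q_def[symmetric] by (rule someI[of Q])
  show ?thesis
  proof (rule analytic_continuation_open[of "unit_disc - \<real>\<^sub>\<le>\<^sub>0" unit_disc "tremblay \<tau> \<mu> f" "tremblay_ext \<tau> \<mu> f"])
    show "unit_disc - \<real>\<^sub>\<le>\<^sub>0 \<noteq> {}"
    proof -
      have "(1/2 :: complex) \<in> unit_disc - \<real>\<^sub>\<le>\<^sub>0"
        by (auto simp: complex_nonpos_Reals_iff)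
      then show ?thesis by blast
    qed
  qed (use Q assms in \<open>auto simp: Q_def holomorphic_tremblay_ext tremblay_slit_eq\<close>)
qed

text \<open>Both terms of \<open>tremblay_ext\<close> are linear in the beta average, which is
  linear in the function; integrability of the two integrands allows the integral to be
  split.\<close>

lemma tremblay_ext_average:
  assumes "\<tau> > 0" "\<tau> - \<mu> < 1" "f1 holomorphic_on unit_disc" "f2 holomorphic_on unit_disc"
    and \<Phi>: "\<And>z. z \<in> unit_disc \<Longrightarrow> \<Phi> z = (f1 z + f2 z) / 2" and z: "z \<in> unit_disc"
  shows "tremblay_ext \<tau> \<mu> \<Phi> z = (tremblay_ext \<tau> \<mu> f1 z + tremblay_ext \<tau> \<mu> f2 z) / 2"
proof -
  define G where "G = beta_average \<tau> (\<tau> - \<mu>)"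
  have G: "G \<Phi> w = (G f1 w + G f2 w) / 2" if w: "w \<in> unit_disc" for w
  proof -
    have "G \<Phi> w = integral {0..1} (\<lambda>t.
        (of_real (t powr (\<tau> - 1) * (1 - t) powr (- (\<tau> - \<mu>))) * f1 (of_real t * w) +
         of_real (t powr (\<tau> - 1) * (1 - t) powr (- (\<tau> - \<mu>))) * f2 (of_real t * w)) / 2)"
      unfolding G_def beta_average_def
    proof (rule integral_cong)
      fix t :: real assume t: "t \<in> {0..1}"
      have "norm (of_real t * w) < 1"
        using t w mult_left_le_one_le[of "norm w" t] by (auto simp: norm_mult)
      then show "of_real (t powr (\<tau> - 1) * (1 - t) powr (- (\<tau> - \<mu>))) * \<Phi> (of_real t * w) =
        (of_real (t powr (\<tau> - 1) * (1 - t) powr (- (\<tau> - \<mu>))) * f1 (of_real t * w) +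
         of_real (t powr (\<tau> - 1) * (1 - t) powr (- (\<tau> - \<mu>))) * f2 (of_real t * w)) / 2"
        by (subst \<Phi>) (auto simp: algebra_simps)
    qed
    also have "\<dots> = (G f1 w + G f2 w) / 2"
      unfolding G_def beta_average_def integral_divide
      by (subst integral_add[OF integrable_beta_average integrable_beta_average])
         (use assms w in auto)
    finally show ?thesis .
  qed
  have hol: "G f1 holomorphic_on unit_disc" "G f2 holomorphic_on unit_disc"
    unfolding G_def using assms by (auto intro!: holomorphic_beta_average)
  have D: "deriv (G \<Phi>) z = (deriv (G f1) z + deriv (G f2) z) / 2"
    by (rule deriv_average[OF hol open_ball G z])
  show ?thesis
    unfolding tremblay_ext_def G_def[symmetric] G[OF z] D
    by (simp add: algebra_simps add_divide_distrib)
qed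

subsection \<open>Convexity of the class\<close>

text \<open>A limit at \<open>z\<close> determines the value of \<open>remove_sings\<close> there.
  Away from 0 it exists by continuity; at 0 the condition \<open>T 0 = 0\<close> makes
  \<open>T w / w\<close> a difference quotient, and the limit is c (p + q) T'(0).\<close>

lemma tendsto_class_expression:
  fixes T :: "complex \<Rightarrow> complex"
  assumes "T holomorphic_on unit_disc" "T 0 = 0" and z: "z \<in> unit_disc"
  shows "\<exists>L. (\<lambda>w. c * inverse w * (p * T w + q * w * deriv T w)) \<midarrow>z\<rightarrow> L"
proof -
  have cont: "T \<midarrow>z\<rightarrow> T z" "deriv T \<midarrow>z\<rightarrow> deriv T z"
    using assms holomorphic_deriv[OF assms(1)]
    by (auto intro!: isContD simp: holomorphic_on_imp_continuous_on
          continuous_on_interior[where S = unit_disc] interior_open)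
  show ?thesis
  proof (cases "z = 0")
    case False
    then show ?thesis
      by (intro exI[of _ "c * inverse z * (p * T z + q * z * deriv T z)"] tendsto_intros cont)
  next
    case True
    have "(T has_field_derivative deriv T 0) (at 0)"
      using holomorphic_derivI[OF assms(1)] by auto
    then have "(\<lambda>w. T w / w) \<midarrow>0\<rightarrow> deriv T 0"
      using assms(2) by (simp add: has_field_derivative_iff)
    then have "(\<lambda>w. c * (p * (T w / w) + q * deriv T w)) \<midarrow>0\<rightarrow> c * (p * deriv T 0 + q * deriv T 0)"
      using cont True by (intro tendsto_intros) auto
    then have "(\<lambda>w. c * inverse w * (p * T w + q * w * deriv T w)) \<midarrow>0\<rightarrow>
                 c * (p * deriv T 0 + q * deriv T 0)"
      by (rule Lim_transform_eventually)
         (auto simp: eventually_at_filter field_simps)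
    then show ?thesis using True by blast
  qed
qed

theorem theorem6:
  fixes k :: nat and \<tau> \<mu> \<delta> \<gamma> :: real
    and a1 a2 :: "nat \<Rightarrow> real" and f1 f2 :: "complex \<Rightarrow> complex"
  assumes "k \<ge> 1"
    and "0 < \<tau>" "\<tau> \<le> 1" and "0 < \<mu>" "\<mu> \<le> 1"
    and "0 \<le> \<tau> - \<mu>" "\<tau> - \<mu> < 1"
    and "0 \<le> \<delta>" "\<delta> < 1" and "0 \<le> \<gamma>" "\<gamma> < 1"
    and "\<tau> - \<mu> + \<gamma> < 1"
    and "has_neg_expansion k a1 f1" and "has_neg_expansion k a2 f2"
    and "f1 \<in> class_P_tremblay \<tau> \<mu> k \<delta> \<gamma>" and "f2 \<in> class_P_tremblay \<tau> \<mu> k \<delta> \<gamma>"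
  shows "(\<lambda>z. z - 1 / 2 * (\<Sum>\<^sub>\<infinity>\<nu>\<in>{k+1..}. of_real (a1 \<nu> + a2 \<nu>) * z ^ \<nu>))
           \<in> class_P_tremblay \<tau> \<mu> k \<delta> \<gamma>"
proof -
  define \<Phi> :: "complex \<Rightarrow> complex" where
    "\<Phi> = (\<lambda>z. z - 1 / 2 * (\<Sum>\<^sub>\<infinity>\<nu>\<in>{k+1..}. of_real (a1 \<nu> + a2 \<nu>) * z ^ \<nu>))"
  have hol: "f1 holomorphic_on unit_disc" "f2 holomorphic_on unit_disc"
    and inj: "inj_on f1 unit_disc" "inj_on f2 unit_disc"
    using assms(15,16) by (auto simp: class_P_tremblay_def class_P_def)
  have sums: "((\<lambda>\<nu>. of_real (a1 \<nu>) * z ^ \<nu>) has_sum (z - f1 z)) {k+1..}"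
    "((\<lambda>\<nu>. of_real (a2 \<nu>) * z ^ \<nu>) has_sum (z - f2 z)) {k+1..}" if "z \<in> unit_disc" for z
    using assms(13,14) that by (auto simp: has_neg_expansion_def)
  have sum: "((\<lambda>\<nu>. of_real (a1 \<nu> + a2 \<nu>) * z ^ \<nu>) has_sum (z - f1 z + (z - f2 z))) {k+1..}"
    if "z \<in> unit_disc" for z
    using has_sum_add[OF sums[OF that]] by (simp add: algebra_simps)
  have \<Phi>: "\<Phi> z = (f1 z + f2 z) / 2" if "z \<in> unit_disc" for z
    unfolding \<Phi>_def infsumI[OF sum[OF that]] by (simp add: field_simps)
  have hol\<Phi>: "\<Phi> holomorphic_on unit_disc"
  proof (rule holomorphic_transform)
    show "(\<lambda>z. (f1 z + f2 z) / 2) holomorphic_on unit_disc"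
      by (intro holomorphic_intros hol) auto
  qed (simp add: \<Phi>)
  have exp\<Phi>: "has_neg_expansion k (\<lambda>\<nu>. (a1 \<nu> + a2 \<nu>) / 2) \<Phi>"
    unfolding has_neg_expansion_def
  proof (intro conjI ballI allI impI)
    fix \<nu> assume "\<nu> \<ge> k + 1"
    then show "0 \<le> (a1 \<nu> + a2 \<nu>) / 2"
      using assms(13,14) by (auto simp: has_neg_expansion_def)
  next
    fix z assume z: "z \<in> unit_disc"
    have *: "((\<lambda>\<nu>. of_real ((a1 \<nu> + a2 \<nu>) / 2) * z ^ \<nu>) has_sum
            ((z - f1 z + (z - f2 z)) * (1 / 2))) {k+1..}"
      using has_sum_cmult_left[OF sum[OF z], of "1 / 2"] by simp
    show "(\<lambda>\<nu>. of_real ((a1 \<nu> + a2 \<nu>) / 2) * z ^ \<nu>) summable_on {k+1..}"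
      using * by (auto simp: summable_on_def)
    show "\<Phi> z = z - (\<Sum>\<^sub>\<infinity>\<nu>\<in>{k+1..}. of_real ((a1 \<nu> + a2 \<nu>) / 2) * z ^ \<nu>)"
      unfolding infsumI[OF *] \<Phi>[OF z] by (simp add: field_simps)
  qed
  \<comment> \<open>Sums of injective maps need not be injective, but positivity of the real part of
    the derivative survives averaging.\<close>
  have "inj_on \<Phi> unit_disc"
  proof (rule inj_on_if_Re_deriv_pos[OF hol\<Phi>])
    fix z assume z: "z \<in> unit_disc"
    have D: "deriv \<Phi> z = (deriv f1 z + deriv f2 z) / 2"
      by (rule deriv_average[OF hol open_ball \<Phi> z])
    show "Re (deriv \<Phi> z) > 0"
      unfolding D using Re_deriv_pos_if_neg_expansion[OF assms(1,13) hol(1) inj(1) z]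
        Re_deriv_pos_if_neg_expansion[OF assms(1,14) hol(2) inj(2) z] by simp
  qed auto
  then have classP: "\<Phi> \<in> class_P k"
    using hol\<Phi> exp\<Phi> by (auto simp: class_P_def)
  define T where "T = tremblay \<tau> \<mu>"
  define C where "C = complex_of_real (Gamma (\<mu> + 1) * Gamma \<tau> / (Gamma (\<tau> + 1) * Gamma \<mu>))"
  define E where "E f w = C * inverse w *
    (of_real (1 - \<delta>) * T f w + of_real \<delta> * w * deriv (T f) w)" for f w
  have class_iff: "f \<in> class_P_tremblay \<tau> \<mu> k \<delta> \<gamma> \<longleftrightarrow>
      f \<in> class_P k \<and> (\<forall>z\<in>unit_disc. Re (remove_sings (E f) z) > \<gamma>)" for f
    unfolding class_P_tremblay_def E_def C_def T_def mem_Collect_eq ..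
  have T_ext: "T f z = tremblay_ext \<tau> \<mu> f z"
    if "f holomorphic_on unit_disc" "z \<in> unit_disc" for f z
    unfolding T_def using assms that by (intro tremblay_eq_tremblay_ext) auto
  have T_hol: "T f holomorphic_on unit_disc" if "f holomorphic_on unit_disc" for f
    using holomorphic_tremblay_ext[of \<tau> \<mu> f] assms that
    by (auto intro: holomorphic_transform simp: T_ext)
  have T0: "T f 0 = 0" if "f holomorphic_on unit_disc" "f 0 = 0" for f
    using that by (simp add: T_ext tremblay_ext_def beta_average_def)
  have zero: "f1 0 = 0" "f2 0 = 0"
    using has_sum_unique[OF sums(1)[of 0] has_sum_0] has_sum_unique[OF sums(2)[of 0] has_sum_0] by auto
  have T\<Phi>: "T \<Phi> z = (T f1 z + T f2 z) / 2" if "z \<in> unit_disc" for z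
    using tremblay_ext_average[OF _ _ hol \<Phi> that] assms that hol hol\<Phi> by (simp add: T_ext)
  have T\<Phi>': "deriv (T \<Phi>) z = (deriv (T f1) z + deriv (T f2) z) / 2" if z: "z \<in> unit_disc" for z
    by (rule deriv_average[OF T_hol[OF hol(1)] T_hol[OF hol(2)] open_ball T\<Phi> z])
  have E\<Phi>: "E \<Phi> w = (E f1 w + E f2 w) / 2" if "w \<in> unit_disc" for w
  proof -
    \<comment> \<open>With \<open>i\<close> standing for \<open>inverse w\<close> the identity needs
      no division by \<open>w\<close>, so it also covers \<open>w = 0\<close>, where
      \<open>inverse w\<close> is 0 by convention.\<close>
    have "c * i * (p * ((x + y) / 2) + q * w * ((x' + y') / 2)) =
        (c * i * (p * x + q * w * x') + c * i * (p * y + q * w * y')) / 2"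
      for c i p q x y x' y' :: complex
      by (simp add: field_simps)
    then show ?thesis
      unfolding E_def T\<Phi>[OF that] T\<Phi>'[OF that] .
  qed
  have "Re (remove_sings (E \<Phi>) z) > \<gamma>" if z: "z \<in> unit_disc" for z
  proof -
    \<comment> \<open>The hypotheses bound the limits \<open>L1\<close> and \<open>L2\<close>
      themselves, as values of \<open>remove_sings\<close>. Averaging these keeps the inequality
      strict, which a passage to the limit in pointwise bounds would not guarantee.\<close>
    obtain L1 where L1: "E f1 \<midarrow>z\<rightarrow> L1"
      using tendsto_class_expression[OF T_hol T0 z] hol zero unfolding E_def by metis
    obtain L2 where L2: "E f2 \<midarrow>z\<rightarrow> L2"
      using tendsto_class_expression[OF T_hol T0 z] hol zero unfolding E_def by metis
    have "\<forall>\<^sub>F w in at z. (E f1 w + E f2 w) / 2 = E \<Phi> w"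
      using eventually_at_in_open'[OF open_ball z] by eventually_elim (simp add: E\<Phi>)
    then have "E \<Phi> \<midarrow>z\<rightarrow> (L1 + L2) / 2"
      by (rule Lim_transform_eventually[rotated]) (intro tendsto_intros L1 L2, simp)
    moreover have "Re L1 > \<gamma>" "Re L2 > \<gamma>"
      using assms(15,16) z remove_sings_eqI[OF L1] remove_sings_eqI[OF L2] by (auto simp: class_iff)
    ultimately show ?thesis
      by (simp add: remove_sings_eqI)
  qed
  then show ?thesis
    using classP unfolding \<Phi>_def[symmetric] class_iff by blast
qed

end
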